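(* If $f\colon X\to Y$ is a fibration, then $$\mathrm{cat}(Y)\le\mathrm{TC}(f)\le\min\{\mathrm{TC}(Y),\mathrm{cat}(X\times Y)\}.$$ In particular, $\mathrm{TC}(f)=1$ if, and only if, $Y$ is contractible.
   Context: All spaces are path-connected metric absolute neighbourhood retracts; "fibration" means Hurewicz fibration, and $f$ is surjective. Let $I=[0,1]$ and let $X^I$ be the space of continuous paths in $X$ with the compact-open topology. For a continuous surjection $p\colon E\to B$, the sectional number $\mathrm{sec}(p)$ is the minimal integer $n$ for which there is an increasing sequence of open subsets $\emptyset=U_0\subseteq U_1\subseteq\cdots\subseteq U_n=B$ such that for each $i=1,\dots,n$ there is a continuous map $s\colon U_i-U_{i-1}\to E$ with $p(s(b))=b$ for all $b$; if no such $n$ exists, $\mathrm{sec}(p)=\infty$. For a space $Z$, $\mathrm{cat}(Z)=\mathrm{sec}(\mathrm{ev}_1\colon PZ\to Z)$, where $PZ\subset Z^I$ is the space of paths starting at a fixed base point and $\mathrm{ev}_1(\alpha)=\alpha(1)$; and $\mathrm{TC}(Z)=\mathrm{sec}(\pi)$, where $\pi\colon Z^I\to Z\times Z$, $\pi(\alpha)=(\alpha(0),\alpha(1))$. For a continuous surjection $f\colon X\to Y$ between path-connected spaces, $\mathrm{TC}(f)=\mathrm{sec}(\pi_f)$, where $\pi_f\colon X^I\to X\times Y$, $\pi_f(\alpha)=(\alpha(0),f(\alpha(1)))$. *)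

theory Defs
  imports "HOL-Analysis.Analysis" "HOL-Library.Extended_Nat"
begin

abbreviation unit_interval :: "real topology" where
  "unit_interval \<equiv> top_of_set {0..1}"

text \<open>A continuous map is represented by its extensional representative, so that distinct points
  of the mapping space are distinct maps.\<close>

definition compact_open_topology :: "'a topology \<Rightarrow> 'b topology \<Rightarrow> ('a \<Rightarrow> 'b) topology" where
  "compact_open_topology X Y =
     topology_generated_by
       {{g \<in> extensional (topspace X). continuous_map X Y g \<and> g ` K \<subseteq> U} | K U.
          compactin X K \<and> openin Y U}"

definition path_space :: "'a topology \<Rightarrow> (real \<Rightarrow> 'a) topology" where
  "path_space X = compact_open_topology unit_interval X"

definition sectional_number :: "'e topology \<Rightarrow> 'b topology \<Rightarrow> ('e \<Rightarrow> 'b) \<Rightarrow> enat" where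
  "sectional_number E B p =
     Inf {enat n | n. \<exists>U :: nat \<Rightarrow> 'b set.
            U 0 = {} \<and> U n = topspace B \<and>
            (\<forall>i\<le>n. openin B (U i)) \<and>
            (\<forall>i<n. U i \<subseteq> U (Suc i)) \<and>
            (\<forall>i\<in>{1..n}. \<exists>s. continuous_map (subtopology B (U i - U (i - 1))) E s \<and>
               (\<forall>b \<in> U i - U (i - 1). p (s b) = b))}"

text \<open>The base point is an explicit argument.\<close>

definition LS_cat :: "'a topology \<Rightarrow> 'a \<Rightarrow> enat" where
  "LS_cat Z z0 =
     sectional_number (subtopology (path_space Z) {\<alpha>. \<alpha> 0 = z0}) Z (\<lambda>\<alpha>. \<alpha> 1)"

definition TC :: "'a topology \<Rightarrow> enat" where
  "TC Z = sectional_number (path_space Z) (prod_topology Z Z) (\<lambda>\<alpha>. (\<alpha> 0, \<alpha> 1))"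

definition TC_map :: "'a topology \<Rightarrow> 'b topology \<Rightarrow> ('a \<Rightarrow> 'b) \<Rightarrow> enat" where
  "TC_map X Y f = sectional_number (path_space X) (prod_topology X Y) (\<lambda>\<alpha>. (\<alpha> 0, f (\<alpha> 1)))"

definition homotopy_lifting_property ::
    "'z topology \<Rightarrow> 'a topology \<Rightarrow> 'b topology \<Rightarrow> ('a \<Rightarrow> 'b) \<Rightarrow> bool" where
  "homotopy_lifting_property Z X Y f \<longleftrightarrow>
     (\<forall>h H. continuous_map Z X h \<longrightarrow>
            continuous_map (prod_topology Z unit_interval) Y H \<longrightarrow>
            (\<forall>z \<in> topspace Z. H (z, 0) = f (h z)) \<longrightarrow>
        (\<exists>L. continuous_map (prod_topology Z unit_interval) X L \<and>
             (\<forall>z \<in> topspace Z. L (z, 0) = h z) \<and>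
             (\<forall>z \<in> topspace Z. \<forall>t \<in> {0..1}. f (L (z, t)) = H (z, t))))"

text \<open>HOL cannot quantify over all types inside a definition, so the test spaces of a Hurewicz
  fibration range over all topologies on one type.  That type accommodates the mapping path space
  of f, which is the universal test space; hence nothing is lost: lemma
  \<open>hurewicz_fibration_lifting\<close> below recovers the lifting property for test spaces of
  every type.\<close>

definition hurewicz_fibration :: "'a topology \<Rightarrow> 'b topology \<Rightarrow> ('a \<Rightarrow> 'b) \<Rightarrow> bool" where
  "hurewicz_fibration X Y f \<longleftrightarrow>
     continuous_map X Y f \<and>
     (\<forall>Z :: ('a \<times> (real \<Rightarrow> 'b)) topology. homotopy_lifting_property Z X Y f)"

text \<open>Absolute neighbourhood retract for the class of metrizable spaces.  The ambient spaces Z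
  again have to range over the topologies on one type.  Real functions on X suffice: by the
  Kuratowski-Wojdyslawski theorem X is closed in a convex subset of the normed space of bounded
  real functions on X, and by Dugundji's extension theorem a neighbourhood retraction there yields
  one in every metrizable space containing X as a closed subset.  (The library constant
  \<open>ANR\<close> is adequate only for subsets of Euclidean spaces.)\<close>

definition metric_ANR :: "'a topology \<Rightarrow> bool" where
  "metric_ANR X \<longleftrightarrow>
     metrizable_space X \<and>
     (\<forall>(Z :: ('a \<Rightarrow> real) topology) e.
        metrizable_space Z \<longrightarrow> embedding_map X Z e \<longrightarrow> closedin Z (e ` topspace X) \<longrightarrow>
        (\<exists>T. openin Z T \<and> (e ` topspace X) retract_of_space (subtopology Z T)))"

lemma topspace_path_space:
  "topspace (path_space Y) = {g \<in> extensional {0..1}. continuous_map unit_interval Y g}"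
  unfolding path_space_def compact_open_topology_def topology_generated_by_topspace
proof (intro equalityI subsetI)
  fix g assume "g \<in> {g \<in> extensional {0..1}. continuous_map unit_interval Y g}"
  then have "g \<in> {g \<in> extensional (topspace unit_interval).
      continuous_map unit_interval Y g \<and> g ` {} \<subseteq> {}}"
    by simp
  then show "g \<in> \<Union> {{g \<in> extensional (topspace unit_interval).
      continuous_map unit_interval Y g \<and> g ` K \<subseteq> U} |K U. compactin unit_interval K \<and> openin Y U}"
    using compactin_empty openin_empty by blast
qed auto

lemma path_space_basic_open:
  assumes "compactin unit_interval K" "openin Y U"
  shows "openin (path_space Y)
    {g \<in> extensional {0..1}. continuous_map unit_interval Y g \<and> g ` K \<subseteq> U}"
  unfolding path_space_def compact_open_topology_def
  by (rule topology_generated_by_Basis) (use assms in auto)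

lemma continuous_map_path_adjoint:
  assumes H: "continuous_map (prod_topology Z unit_interval) Y H"
  shows "continuous_map Z (path_space Y) (\<lambda>z. restrict (\<lambda>t. H (z, t)) {0..1})"
proof -
  let ?F = "\<lambda>z. restrict (\<lambda>t. H (z, t)) {0..1}"
  have slice: "continuous_map unit_interval Y (?F z)" if "z \<in> topspace Z" for z
  proof -
    have "continuous_map unit_interval (prod_topology Z unit_interval) (\<lambda>t. (z, t))"
      using that by (simp add: continuous_map_pairwise o_def)
    then have "continuous_map unit_interval Y (\<lambda>t. H (z, t))"
      using continuous_map_compose[OF _ H] by (simp add: o_def)
    then show ?thesis
      by (rule continuous_map_eq) auto
  qed
  have "openin Z (?F -` W \<inter> topspace Z)"
    if W: "W = {g \<in> extensional (topspace unit_interval). continuous_map unit_interval Y g \<and> g ` K \<subseteq> U}"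
      and K: "compactin unit_interval K" and U: "openin Y U" for W K U
  proof (subst openin_subopen, intro ballI)
    fix z assume z: "z \<in> ?F -` W \<inter> topspace Z"
    have K01: "K \<subseteq> {0..1}"
      using compactin_subset_topspace[OF K] by simp
    let ?P = "{w \<in> topspace (prod_topology Z unit_interval). H w \<in> U}"
    have P: "openin (prod_topology Z unit_interval) ?P"
      using openin_continuous_map_preimage[OF H U] .
    have "H (z, t) \<in> U" if "t \<in> K" for t
    proof -
      have "?F z t \<in> U"
        using z that unfolding W by blast
      then show ?thesis
        using that K01 by auto
    qed
    then have zK: "{z} \<times> K \<subseteq> ?P"
      using z K01 by auto
    have "z \<in> topspace Z"
      using z by simp
    then obtain A B where AB: "openin Z A" "z \<in> A" "K \<subseteq> B" "A \<times> B \<subseteq> ?P"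
      using tube_lemma_right[OF P K _ zK] by blast
    have "A \<subseteq> ?F -` W \<inter> topspace Z"
    proof
      fix a assume a: "a \<in> A"
      have "a \<in> topspace Z"
        using AB(1) a openin_subset by blast
      moreover have "?F a ` K \<subseteq> U"
      proof
        fix y assume "y \<in> ?F a ` K"
        then obtain t where "t \<in> K" "y = H (a, t)"
          using K01 by auto
        then show "y \<in> U"
          using AB(3,4) a by blast
      qed
      ultimately show "a \<in> ?F -` W \<inter> topspace Z"
        using slice[of a] unfolding W by simp
    qed
    with AB(1,2)
    show "\<exists>T. openin Z T \<and> z \<in> T \<and> T \<subseteq> ?F -` W \<inter> topspace Z"
      by blast
  qed
  moreover have "?F ` topspace Z \<subseteq> topspace (path_space Y)"
    using slice by (auto simp: topspace_path_space)
  ultimately show ?thesis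
    unfolding path_space_def compact_open_topology_def
    by (intro continuous_on_generated_topo) (blast, simp only: topology_generated_by_topspace)
qed

lemma continuous_map_path_eval:
  "continuous_map (prod_topology (path_space Y) unit_interval) Y (\<lambda>(g, t). g t)"
  unfolding continuous_map_def
proof (intro conjI allI impI)
  show "(\<lambda>(g, t). g t) \<in> topspace (prod_topology (path_space Y) unit_interval) \<rightarrow> topspace Y"
    by (auto simp: topspace_path_space continuous_map_def Pi_iff)
next
  fix U assume U: "openin Y U"
  let ?P = "{w \<in> topspace (prod_topology (path_space Y) unit_interval). (case w of (g, t) \<Rightarrow> g t) \<in> U}"
  show "openin (prod_topology (path_space Y) unit_interval) ?P"
  proof (subst openin_subopen, intro ballI)
    fix w assume "w \<in> ?P"
    then obtain g t where w: "w = (g, t)" and g: "g \<in> extensional {0..1}"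
      "continuous_map unit_interval Y g" and t: "t \<in> {0..1}" "g t \<in> U"
      by (auto simp: topspace_path_space)
    have "openin unit_interval {s \<in> {0..1}. g s \<in> U}"
      using openin_continuous_map_preimage[OF g(2) U] by simp
    then obtain e where e: "e > 0" "\<forall>s \<in> {0..1}. dist s t < e \<longrightarrow> g s \<in> U"
      using t unfolding openin_euclidean_subtopology_iff by auto
    define K where "K = {0..1} \<inter> cball t (e/2)"
    have K: "compactin unit_interval K"
      by (auto simp: K_def compactin_subtopology compact_Int)
    let ?A = "{g \<in> extensional {0..1}. continuous_map unit_interval Y g \<and> g ` K \<subseteq> U}"
    let ?B = "{0..1} \<inter> ball t (e/2)"
    have "openin (prod_topology (path_space Y) unit_interval) (?A \<times> ?B)"
      using path_space_basic_open[OF K U]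
      by (simp add: openin_prod_Times_iff openin_open_Int)
    moreover have "g ` K \<subseteq> U"
      using e by (auto simp: K_def dist_commute)
    then have "w \<in> ?A \<times> ?B"
      using w g t e by auto
    moreover have "?A \<times> ?B \<subseteq> ?P"
      by (auto simp: topspace_path_space K_def)
    ultimately show "\<exists>T. openin (prod_topology (path_space Y) unit_interval) T \<and> w \<in> T \<and> T \<subseteq> ?P"
      by blast
  qed
qed

lemma hurewicz_fibration_lifting:
  fixes Z :: "'c topology"
  assumes "hurewicz_fibration X Y f"
  shows "homotopy_lifting_property Z X Y f"
  unfolding homotopy_lifting_property_def
proof (intro allI impI)
  fix h H
  assume h: "continuous_map Z X h" and H: "continuous_map (prod_topology Z unit_interval) Y H"
    and hH: "\<forall>z \<in> topspace Z. H (z, 0) = f (h z)"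
  let ?I = "unit_interval"
  define W where "W = subtopology (prod_topology X (path_space Y)) {(x, g). g 0 = f x}"
  define k where "k z = (h z, restrict (\<lambda>t. H (z, t)) {0..1})" for z
  have k: "continuous_map Z W k"
    unfolding W_def continuous_map_in_subtopology k_def
    using h continuous_map_path_adjoint[OF H] hH by (auto simp: continuous_map_pairwise o_def)
  have fstW: "continuous_map W X fst"
    unfolding W_def by (intro continuous_map_from_subtopology continuous_map_fst)
  have sndW: "continuous_map W (path_space Y) snd"
    unfolding W_def by (intro continuous_map_from_subtopology continuous_map_snd)
  have "continuous_map (prod_topology W ?I) (prod_topology (path_space Y) ?I) (\<lambda>(w, t). (snd w, t))"
    using continuous_map_compose[OF continuous_map_fst sndW] continuous_map_snd
    by (auto simp: continuous_map_pairwise o_def case_prod_unfold)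
  then have "continuous_map (prod_topology W ?I) Y ((\<lambda>(g, t). g t) \<circ> (\<lambda>(w, t). (snd w, t)))"
    by (rule continuous_map_compose[OF _ continuous_map_path_eval])
  moreover have "homotopy_lifting_property W X Y f"
    using assms by (simp add: hurewicz_fibration_def)
  moreover have "\<forall>w \<in> topspace W. ((\<lambda>(g, t). g t) \<circ> (\<lambda>(w, t). (snd w, t))) (w, 0) = f (fst w)"
    by (auto simp: W_def)
  ultimately have "\<exists>L. continuous_map (prod_topology W ?I) X L \<and>
      (\<forall>w \<in> topspace W. L (w, 0) = fst w) \<and>
      (\<forall>w \<in> topspace W. \<forall>t \<in> {0..1}.
         f (L (w, t)) = ((\<lambda>(g, t). g t) \<circ> (\<lambda>(w, t). (snd w, t))) (w, t))"
    using fstW unfolding homotopy_lifting_property_def by blast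
  then obtain L where L: "continuous_map (prod_topology W ?I) X L"
      "\<forall>w \<in> topspace W. L (w, 0) = fst w"
      "\<forall>w \<in> topspace W. \<forall>t \<in> {0..1}. f (L (w, t)) = snd w t"
    by (auto simp: o_def)
  have kW: "k z \<in> topspace W" if "z \<in> topspace Z" for z
    using k that by (auto simp: continuous_map_def)
  have "continuous_map (prod_topology Z ?I) (prod_topology W ?I) (\<lambda>(z, t). (k z, t))"
    using continuous_map_compose[OF continuous_map_fst k] continuous_map_snd
    by (auto simp: continuous_map_pairwise o_def case_prod_unfold)
  then have "continuous_map (prod_topology Z ?I) X (\<lambda>(z, t). L (k z, t))"
    using continuous_map_compose[OF _ L(1)] by (fastforce simp: o_def case_prod_unfold)
  then show "\<exists>L. continuous_map (prod_topology Z ?I) X L \<and> (\<forall>z \<in> topspace Z. L (z, 0) = h z) \<and>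
      (\<forall>z \<in> topspace Z. \<forall>t \<in> {0..1}. f (L (z, t)) = H (z, t))"
    using L(2,3) kW by (intro exI[of _ "\<lambda>(z, t). L (k z, t)"]) (auto simp: k_def)
qed

end

theory Submission
  imports Defs
begin

text \<open>A section of the path fibration over \<open>A\<close> is a homotopy between two maps defined on
  \<open>A\<close>. For a fibration \<open>f\<close>, homotopy lifting turns a homotopy
  \<open>f \<circ> fst \<simeq> snd\<close> on \<open>A \<subseteq> X \<times> Y\<close> into a section of \<open>\<pi>\<^sub>f\<close> over \<open>A\<close>, so all
  the sectional numbers involved count pieces on which two given maps are homotopic.  The
  inequalities then come from pulling such pieces back along \<open>y \<mapsto> (x\<^sub>0, y)\<close>,
  \<open>f \<times> id\<close> and \<open>id\<close>.\<close>

section \<open>Local sections and sectional numbers\<close>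

text \<open>\<open>A\<close> ranges over arbitrary sets, not just open ones, because the pieces
  \<open>U i - U (i - 1)\<close> of a filtration are differences of open sets.\<close>

definition local_section :: "'e topology \<Rightarrow> 'b topology \<Rightarrow> ('e \<Rightarrow> 'b) \<Rightarrow> 'b set \<Rightarrow> bool" where
  "local_section E B p A \<longleftrightarrow>
     (\<exists>s. continuous_map (subtopology B A) E s \<and> (\<forall>b \<in> A. p (s b) = b))"

text \<open>Preimages under \<open>g\<close> turn a filtration of \<open>B\<close> into one of
  \<open>B'\<close> of the same length, and commute with differences. So every length admissible for
  \<open>p\<close> is admissible for \<open>p'\<close>, which also covers the value
  \<open>\<infinity>\<close>. No map \<open>E \<rightarrow> E'\<close> is asked for:
  \<open>pull\<close> only transfers the existence of sections, so it can be checked through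
  homotopies.\<close>

lemma sectional_number_pullback:
  assumes g: "continuous_map B' B g"
    and pull: "\<And>A. A \<subseteq> topspace B \<Longrightarrow> local_section E B p A \<Longrightarrow>
      local_section E' B' p' {b \<in> topspace B'. g b \<in> A}"
  shows "sectional_number E' B' p' \<le> sectional_number E B p"
  unfolding sectional_number_def
proof (rule Inf_superset_mono, safe)
  fix n :: nat and U :: "nat \<Rightarrow> 'b set"
  assume U: "U 0 = {}" "U n = topspace B" "\<forall>i\<le>n. openin B (U i)" "\<forall>i<n. U i \<subseteq> U (Suc i)"
    and s: "\<forall>i\<in>{1..n}. \<exists>s. continuous_map (subtopology B (U i - U (i - 1))) E s \<and>
               (\<forall>b \<in> U i - U (i - 1). p (s b) = b)"
  define V where "V i = {b \<in> topspace B'. g b \<in> U i}" for i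
  have "V n = topspace B'"
    using g U(2) by (auto simp: V_def continuous_map_def)
  moreover have "\<forall>i\<le>n. openin B' (V i)"
    unfolding V_def using U(3) openin_continuous_map_preimage[OF g] by blast
  moreover have "local_section E' B' p' (V i - V (i - 1))" if i: "i \<in> {1..n}" for i
  proof -
    have "U i - U (i - 1) \<subseteq> topspace B"
      using U(3) i openin_subset by fastforce
    then have "local_section E' B' p' {b \<in> topspace B'. g b \<in> U i - U (i - 1)}"
      using s i by (intro pull) (auto simp: local_section_def)
    also have "{b \<in> topspace B'. g b \<in> U i - U (i - 1)} = V i - V (i - 1)"
      by (auto simp: V_def)
    finally show ?thesis .
  qed
  moreover have "V 0 = {}" "\<forall>i<n. V i \<subseteq> V (Suc i)"
    using U(1,4) by (auto simp: V_def)
  ultimately have "V 0 = {} \<and> V n = topspace B' \<and>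
      (\<forall>i\<le>n. openin B' (V i)) \<and> (\<forall>i<n. V i \<subseteq> V (Suc i)) \<and>
      (\<forall>i\<in>{1..n}. \<exists>s. continuous_map (subtopology B' (V i - V (i - 1))) E' s \<and>
         (\<forall>b \<in> V i - V (i - 1). p' (s b) = b))"
    unfolding local_section_def by simp
  then show "\<exists>n'. enat n = enat n' \<and> (\<exists>V. V 0 = {} \<and> V n' = topspace B' \<and>
      (\<forall>i\<le>n'. openin B' (V i)) \<and> (\<forall>i<n'. V i \<subseteq> V (Suc i)) \<and>
      (\<forall>i\<in>{1..n'}. \<exists>s. continuous_map (subtopology B' (V i - V (i - 1))) E' s \<and>
         (\<forall>b \<in> V i - V (i - 1). p' (s b) = b)))"
    by (intro exI[of _ n] exI[of _ V] conjI refl) simp_all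
qed

text \<open>Nonemptiness of the base rules out length 0, where \<open>U 0 = U n\<close> would be
  both empty and everything. A filtration of length 1 has the whole base as its only piece.\<close>

lemma sectional_number_eq_1_iff:
  fixes B :: "'b topology"
  assumes "topspace B \<noteq> {}"
  shows "sectional_number E B p = 1 \<longleftrightarrow> local_section E B p (topspace B)"
proof -
  define S where "S = {enat n | n. \<exists>U :: nat \<Rightarrow> 'b set.
            U 0 = {} \<and> U n = topspace B \<and>
            (\<forall>i\<le>n. openin B (U i)) \<and>
            (\<forall>i<n. U i \<subseteq> U (Suc i)) \<and>
            (\<forall>i\<in>{1..n}. \<exists>s. continuous_map (subtopology B (U i - U (i - 1))) E s \<and>
               (\<forall>b \<in> U i - U (i - 1). p (s b) = b))}"
  have sn: "sectional_number E B p = Inf S"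
    by (simp add: sectional_number_def S_def)
  have ge: "1 \<le> Inf S"
  proof (rule Inf_greatest)
    fix x assume "x \<in> S"
    then obtain n and U :: "nat \<Rightarrow> 'b set"
      where "x = enat n" "U 0 = {}" "U n = topspace B"
      unfolding S_def by blast
    then show "1 \<le> x"
      using assms by (cases n) (auto simp: one_enat_def)
  qed
  show ?thesis
  proof
    assume "sectional_number E B p = 1"
    \<comment> \<open>The infimum of the empty set is \<open>\<infinity>\<close>, and in
      \<open>enat\<close> a nonempty set attains its infimum, so 1 is itself an admissible
      length.\<close>
    then have "S \<noteq> {}" "Inf S = 1"
      by (auto simp: sn Inf_enat_def one_enat_def)
    then have "enat 1 \<in> S"
      by (metis Inf_enat_def LeastI_ex ex_in_conv one_enat_def)
    then obtain U :: "nat \<Rightarrow> 'b set" where "U 0 = {}" "U 1 = topspace B"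
      "\<exists>s. continuous_map (subtopology B (U 1 - U 0)) E s \<and> (\<forall>b \<in> U 1 - U 0. p (s b) = b)"
      unfolding S_def by fastforce
    then show "local_section E B p (topspace B)"
      by (simp add: local_section_def)
  next
    assume sec: "local_section E B p (topspace B)"
    have "enat 1 \<in> S"
      unfolding S_def mem_Collect_eq
      by (intro exI[of _ 1] exI[of _ "\<lambda>i. if i = 0 then {} else topspace B"] conjI)
        (use sec in \<open>auto simp: local_section_def\<close>)
    then show "sectional_number E B p = 1"
      using ge by (metis Inf_lower antisym one_enat_def sn)
  qed
qed

section \<open>Sections of path fibrations as homotopies\<close>

text \<open>This is the exponential law for the unit interval: one direction is the adjoint map into
  the path space, the other is composition with the continuous evaluation.\<close>

lemma homotopic_with_path_space_iff:
  "homotopic_with (\<lambda>_. True) Z Y p q \<longleftrightarrow>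
     (\<exists>s. continuous_map Z (path_space Y) s \<and>
          (\<forall>z \<in> topspace Z. s z 0 = p z \<and> s z 1 = q z))"
proof
  assume "homotopic_with (\<lambda>_. True) Z Y p q"
  then obtain h where h: "continuous_map (prod_topology unit_interval Z) Y h"
    "\<forall>z. h (0, z) = p z" "\<forall>z. h (1, z) = q z"
    by (auto simp: homotopic_with_def)
  have "continuous_map (prod_topology Z unit_interval) Y (h \<circ> (\<lambda>(z, t). (t, z)))"
    by (rule continuous_map_compose[OF _ h(1)])
      (simp add: case_prod_unfold continuous_map_pairedI continuous_map_fst continuous_map_snd)
  from continuous_map_path_adjoint[OF this]
  show "\<exists>s. continuous_map Z (path_space Y) s \<and>
          (\<forall>z \<in> topspace Z. s z 0 = p z \<and> s z 1 = q z)"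
    using h(2,3) by (intro exI conjI) auto
next
  assume "\<exists>s. continuous_map Z (path_space Y) s \<and>
          (\<forall>z \<in> topspace Z. s z 0 = p z \<and> s z 1 = q z)"
  then obtain s where s: "continuous_map Z (path_space Y) s"
    "\<forall>z \<in> topspace Z. s z 0 = p z \<and> s z 1 = q z"
    by blast
  have "continuous_map (prod_topology unit_interval Z) (prod_topology (path_space Y) unit_interval)
      (\<lambda>w. (s (snd w), fst w))"
    using continuous_map_compose[OF continuous_map_snd s(1)]
    by (intro continuous_map_pairedI) (auto simp: o_def continuous_map_fst)
  from continuous_map_compose[OF this continuous_map_path_eval]
  have "continuous_map (prod_topology unit_interval Z) Y (\<lambda>w. s (snd w) (fst w))"
    by (simp add: o_def)
  \<comment> \<open>By definition \<open>homotopic_with\<close> fixes the end maps at every point of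
    the type. The rule \<open>homotopic_with\<close> asks for them only on the space, where
    \<open>s\<close> is controlled.\<close>
  then show "homotopic_with (\<lambda>_. True) Z Y p q"
    using s(2) by (subst homotopic_with) auto
qed

text \<open>The map \<open>k\<close> is the end of the lifted homotopy that starts at
  \<open>h\<close>; it lies over the end \<open>q\<close> of the given one.\<close>

lemma hurewicz_fibration_lift_homotopy:
  assumes f: "hurewicz_fibration X Y f" and h: "continuous_map Z X h"
    and hom: "homotopic_with (\<lambda>_. True) Z Y (f \<circ> h) q"
  obtains k where "homotopic_with (\<lambda>_. True) Z X h k" "\<And>z. z \<in> topspace Z \<Longrightarrow> f (k z) = q z"
proof -
  obtain H where H: "continuous_map (prod_topology unit_interval Z) Y H"
    "\<forall>z. H (0, z) = f (h z)" "\<forall>z. H (1, z) = q z"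
    using hom by (auto simp: homotopic_with_def)
  \<comment> \<open>\<open>homotopic_with\<close> puts the interval first in the product,
    \<open>homotopy_lifting_property\<close> puts it second.\<close>
  have swap: "continuous_map (prod_topology A B) (prod_topology B A) (\<lambda>(x, y). (y, x))"
    for A :: "'x topology" and B :: "'y topology"
    by (simp add: case_prod_unfold continuous_map_pairedI continuous_map_fst continuous_map_snd)
  have "homotopy_lifting_property Z X Y f"
    using f by (rule hurewicz_fibration_lifting)
  moreover have "continuous_map (prod_topology Z unit_interval) Y (H \<circ> (\<lambda>(z, t). (t, z)))"
    using continuous_map_compose[OF swap H(1)] .
  moreover have "\<forall>z \<in> topspace Z. (H \<circ> (\<lambda>(z, t). (t, z))) (z, 0) = f (h z)"
    using H(2) by simp
  ultimately have "\<exists>L. continuous_map (prod_topology Z unit_interval) X L \<and>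
      (\<forall>z \<in> topspace Z. L (z, 0) = h z) \<and>
      (\<forall>z \<in> topspace Z. \<forall>t \<in> {0..1}. f (L (z, t)) = (H \<circ> (\<lambda>(z, t). (t, z))) (z, t))"
    using h unfolding homotopy_lifting_property_def by blast
  then obtain L where L: "continuous_map (prod_topology Z unit_interval) X L"
    "\<forall>z \<in> topspace Z. L (z, 0) = h z"
    "\<forall>z \<in> topspace Z. \<forall>t \<in> {0..1}. f (L (z, t)) = H (t, z)"
    by auto
  show ?thesis
  proof (rule that[of "\<lambda>z. L (z, 1)"])
    show "homotopic_with (\<lambda>_. True) Z X h (\<lambda>z. L (z, 1))"
      using continuous_map_compose[OF swap L(1)] L(2)
      by (subst homotopic_with) (auto intro!: exI[of _ "L \<circ> (\<lambda>(t, z). (z, t))"])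
    show "f (L (z, 1)) = q z" if "z \<in> topspace Z" for z
      using that L(3) H(3) by simp
  qed
qed

text \<open>On \<open>subtopology Z A\<close> the map \<open>id\<close> is the inclusion, so the
  right side says that \<open>A\<close> contracts inside \<open>Z\<close> to \<open>z0\<close>, as
  in the classical category of Lusternik and Schnirelmann.\<close>

lemma local_section_LS_cat_iff:
  assumes "A \<subseteq> topspace Z"
  shows "local_section (subtopology (path_space Z) {\<alpha>. \<alpha> 0 = z0}) Z (\<lambda>\<alpha>. \<alpha> 1) A \<longleftrightarrow>
    homotopic_with (\<lambda>_. True) (subtopology Z A) Z (\<lambda>_. z0) id"
  unfolding local_section_def homotopic_with_path_space_iff continuous_map_in_subtopology
  using assms by (fastforce simp: topspace_subtopology_subset)

lemma local_section_TC_iff: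
  assumes "A \<subseteq> topspace (prod_topology Z Z)"
  shows "local_section (path_space Z) (prod_topology Z Z) (\<lambda>\<alpha>. (\<alpha> 0, \<alpha> 1)) A \<longleftrightarrow>
    homotopic_with (\<lambda>_. True) (subtopology (prod_topology Z Z) A) Z fst snd"
  unfolding local_section_def homotopic_with_path_space_iff topspace_subtopology_subset[OF assms]
  by (simp add: prod_eq_iff)

text \<open>Applying \<open>f\<close> to the paths of a section gives the homotopy in
  \<open>Y\<close>. Conversely, lifting a homotopy from \<open>f \<circ> fst\<close> to
  \<open>snd\<close> with start \<open>fst\<close> gives paths in \<open>X\<close> whose ends lie
  over the second coordinate.\<close>

lemma local_section_TC_map_iff:
  assumes f: "hurewicz_fibration X Y f" and A: "A \<subseteq> topspace (prod_topology X Y)"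
  shows "local_section (path_space X) (prod_topology X Y) (\<lambda>\<alpha>. (\<alpha> 0, f (\<alpha> 1))) A \<longleftrightarrow>
    homotopic_with (\<lambda>_. True) (subtopology (prod_topology X Y) A) Y (f \<circ> fst) snd"
    (is "?sec \<longleftrightarrow> homotopic_with _ ?A Y _ _")
proof
  have topA: "topspace ?A = A"
    using A by (rule topspace_subtopology_subset)
  {
    assume ?sec
    then obtain s where s: "continuous_map ?A (path_space X) s" "\<forall>b\<in>A. (s b 0, f (s b 1)) = b"
      by (auto simp: local_section_def)
    then have "homotopic_with (\<lambda>_. True) ?A X (\<lambda>b. s b 0) (\<lambda>b. s b 1)"
      by (auto simp: homotopic_with_path_space_iff)
    then have "homotopic_with (\<lambda>_. True) ?A Y (f \<circ> (\<lambda>b. s b 0)) (f \<circ> (\<lambda>b. s b 1))"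
      by (rule homotopic_with_compose_continuous_map_left)
        (use f in \<open>auto simp: hurewicz_fibration_def\<close>)
    then show "homotopic_with (\<lambda>_. True) ?A Y (f \<circ> fst) snd"
      by (rule homotopic_with_eq) (use s(2) in \<open>auto simp: topA prod_eq_iff\<close>)
  }
  assume "homotopic_with (\<lambda>_. True) ?A Y (f \<circ> fst) snd"
  then obtain k where "homotopic_with (\<lambda>_. True) ?A X fst k" "\<And>b. b \<in> A \<Longrightarrow> f (k b) = snd b"
    using hurewicz_fibration_lift_homotopy[OF f, of ?A fst snd] topA
    by (metis continuous_map_from_subtopology continuous_map_fst)
  then show ?sec
    unfolding local_section_def homotopic_with_path_space_iff topA by (auto simp: prod_eq_iff)
qed

section \<open>The three inequalities and the value 1\<close>

text \<open>On the slice \<open>{x0} \<times> Y\<close> the map \<open>f \<circ> fst\<close> becomes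
  constant at \<open>f x0\<close> and \<open>snd\<close> becomes the identity.\<close>

lemma LS_cat_le_TC_map:
  assumes f: "hurewicz_fibration X Y f" and x0: "x0 \<in> topspace X"
  shows "LS_cat Y (f x0) \<le> TC_map X Y f"
  unfolding LS_cat_def TC_map_def
proof (rule sectional_number_pullback[where g = "\<lambda>y. (x0, y)"])
  show cont: "continuous_map Y (prod_topology X Y) (\<lambda>y. (x0, y))"
    using x0 by (simp add: continuous_map_pairedI)
  fix A
  assume A: "A \<subseteq> topspace (prod_topology X Y)"
    and "local_section (path_space X) (prod_topology X Y) (\<lambda>\<alpha>. (\<alpha> 0, f (\<alpha> 1))) A"
  then have "homotopic_with (\<lambda>_. True) (subtopology (prod_topology X Y) A) Y (f \<circ> fst) snd"
    by (simp add: local_section_TC_map_iff[OF f])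
  moreover have "continuous_map (subtopology Y {y \<in> topspace Y. (x0, y) \<in> A})
      (subtopology (prod_topology X Y) A) (\<lambda>y. (x0, y))"
    using cont by (auto simp: continuous_map_in_subtopology continuous_map_from_subtopology)
  ultimately have "homotopic_with (\<lambda>_. True) (subtopology Y {y \<in> topspace Y. (x0, y) \<in> A}) Y
      ((f \<circ> fst) \<circ> (\<lambda>y. (x0, y))) (snd \<circ> (\<lambda>y. (x0, y)))"
    by (rule homotopic_with_compose_continuous_map_right) simp
  then show "local_section (subtopology (path_space Y) {\<alpha>. \<alpha> 0 = f x0}) Y (\<lambda>\<alpha>. \<alpha> 1)
      {y \<in> topspace Y. (x0, y) \<in> A}"
    by (subst local_section_LS_cat_iff) (auto simp: o_def id_def)
qed

text \<open>Composing \<open>fst\<close> and \<open>snd\<close> on \<open>Y \<times> Y\<close> with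
  \<open>map_prod f id\<close> gives exactly \<open>f \<circ> fst\<close> and
  \<open>snd\<close>.\<close>

lemma TC_map_le_TC:
  assumes f: "hurewicz_fibration X Y f"
  shows "TC_map X Y f \<le> TC Y"
  unfolding TC_def TC_map_def
proof (rule sectional_number_pullback[where g = "map_prod f id"])
  have "continuous_map (prod_topology X Y) Y (f \<circ> fst)"
    using f by (auto simp: hurewicz_fibration_def intro: continuous_map_compose continuous_map_fst)
  then show cont: "continuous_map (prod_topology X Y) (prod_topology Y Y) (map_prod f id)"
    by (simp add: map_prod_def case_prod_unfold continuous_map_pairedI continuous_map_snd o_def)
  fix A
  assume A: "A \<subseteq> topspace (prod_topology Y Y)"
    and "local_section (path_space Y) (prod_topology Y Y) (\<lambda>\<alpha>. (\<alpha> 0, \<alpha> 1)) A"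
  then have "homotopic_with (\<lambda>_. True) (subtopology (prod_topology Y Y) A) Y fst snd"
    by (simp add: local_section_TC_iff)
  moreover have "continuous_map
      (subtopology (prod_topology X Y) {b \<in> topspace (prod_topology X Y). map_prod f id b \<in> A})
      (subtopology (prod_topology Y Y) A) (map_prod f id)"
    using cont by (auto simp: continuous_map_in_subtopology continuous_map_from_subtopology)
  ultimately have "homotopic_with (\<lambda>_. True)
      (subtopology (prod_topology X Y) {b \<in> topspace (prod_topology X Y). map_prod f id b \<in> A})
      Y (fst \<circ> map_prod f id) (snd \<circ> map_prod f id)"
    by (rule homotopic_with_compose_continuous_map_right) simp
  then show "local_section (path_space X) (prod_topology X Y) (\<lambda>\<alpha>. (\<alpha> 0, f (\<alpha> 1)))
      {b \<in> topspace (prod_topology X Y). map_prod f id b \<in> A}"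
    by (subst local_section_TC_map_iff[OF f]) (auto simp: comp_def)
qed

text \<open>Where the inclusion into the product is nullhomotopic, both \<open>f \<circ> fst\<close>
  and \<open>snd\<close> are homotopic to constants.\<close>

lemma TC_map_le_LS_cat_prod:
  assumes f: "hurewicz_fibration X Y f" and Y: "path_connected_space Y"
    and w0: "w0 \<in> topspace (prod_topology X Y)"
  shows "TC_map X Y f \<le> LS_cat (prod_topology X Y) w0"
  unfolding LS_cat_def TC_map_def
proof (rule sectional_number_pullback[where g = id])
  let ?P = "prod_topology X Y"
  have contf: "continuous_map ?P Y (f \<circ> fst)"
    using f by (auto simp: hurewicz_fibration_def intro: continuous_map_compose continuous_map_fst)
  show "continuous_map ?P ?P id"
    by simp
  fix A
  assume A: "A \<subseteq> topspace ?P"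
    and "local_section (subtopology (path_space ?P) {\<alpha>. \<alpha> 0 = w0}) ?P (\<lambda>\<alpha>. \<alpha> 1) A"
  then have null: "homotopic_with (\<lambda>_. True) (subtopology ?P A) ?P (\<lambda>_. w0) id"
    by (simp add: local_section_LS_cat_iff)
  have "homotopic_with (\<lambda>_. True) (subtopology ?P A) Y (\<lambda>_. f (fst w0)) (f \<circ> fst)"
    using homotopic_with_compose_continuous_map_left[OF null contf] by (simp add: o_def)
  moreover have "homotopic_with (\<lambda>_. True) (subtopology ?P A) Y (\<lambda>_. snd w0) snd"
    using homotopic_with_compose_continuous_map_left[OF null continuous_map_snd]
    by (simp add: o_def)
  \<comment> \<open>The base point \<open>w0\<close> need not lie on the graph of \<open>f\<close>,
    so a path in \<open>Y\<close> has to join the two constants.\<close>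
  moreover have "path_component_of Y (f (fst w0)) (snd w0)"
    using Y w0 contf
    by (auto simp: path_connected_space_iff_path_component continuous_map_def Pi_iff)
  then have "homotopic_with (\<lambda>_. True) (subtopology ?P A) Y (\<lambda>_. f (fst w0)) (\<lambda>_. snd w0)"
    by (simp add: homotopic_constant_maps)
  ultimately have "homotopic_with (\<lambda>_. True) (subtopology ?P A) Y (f \<circ> fst) snd"
    by (meson homotopic_with_symD homotopic_with_trans)
  moreover have "{b \<in> topspace ?P. id b \<in> A} = A"
    using A by auto
  ultimately show "local_section (path_space X) ?P (\<lambda>\<alpha>. (\<alpha> 0, f (\<alpha> 1)))
      {b \<in> topspace ?P. id b \<in> A}"
    using A by (simp add: local_section_TC_map_iff[OF f])
qed

text \<open>The value 1 means \<open>f \<circ> fst\<close> and \<open>snd\<close> are homotopic on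
  the whole product. Restricting to a slice \<open>{x0} \<times> Y\<close> makes the identity of
  \<open>Y\<close> nullhomotopic; conversely, any two maps into a contractible space are
  homotopic.\<close>

lemma TC_map_eq_1_iff:
  assumes f: "hurewicz_fibration X Y f" and X: "topspace X \<noteq> {}"
  shows "TC_map X Y f = 1 \<longleftrightarrow> contractible_space Y"
proof -
  let ?P = "prod_topology X Y"
  obtain x0 where x0: "x0 \<in> topspace X"
    using X by blast
  have contf: "continuous_map X Y f"
    using f by (simp add: hurewicz_fibration_def)
  then have "topspace ?P \<noteq> {}"
    using x0 by (auto simp: continuous_map_def)
  then have "TC_map X Y f = 1 \<longleftrightarrow> homotopic_with (\<lambda>_. True) ?P Y (f \<circ> fst) snd"
    unfolding TC_map_def
    by (subst sectional_number_eq_1_iff, assumption, subst local_section_TC_map_iff[OF f])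
      (simp_all only: subset_refl subtopology_topspace)
  also have "\<dots> \<longleftrightarrow> contractible_space Y"
  proof
    assume "homotopic_with (\<lambda>_. True) ?P Y (f \<circ> fst) snd"
    moreover have "continuous_map Y ?P (\<lambda>y. (x0, y))"
      using x0 by (simp add: continuous_map_pairedI)
    ultimately have "homotopic_with (\<lambda>_. True) Y Y ((f \<circ> fst) \<circ> (\<lambda>y. (x0, y))) (snd \<circ> (\<lambda>y. (x0, y)))"
      by (rule homotopic_with_compose_continuous_map_right) simp
    then have "homotopic_with (\<lambda>_. True) Y Y id (\<lambda>_. f x0)"
      by (simp add: o_def id_def homotopic_with_sym)
    then show "contractible_space Y"
      unfolding contractible_space_def by blast
  next
    assume "contractible_space Y"
    then show "homotopic_with (\<lambda>_. True) ?P Y (f \<circ> fst) snd"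
      using continuous_map_compose[OF continuous_map_fst contf] continuous_map_snd
      by (intro homotopic_into_contractible_space conjI) auto
  qed
  finally show ?thesis .
qed

theorem proposition4p7:
  fixes X :: "'a topology" and Y :: "'b topology" and f :: "'a \<Rightarrow> 'b"
    and y0 :: 'b and w0 :: "'a \<times> 'b"
  assumes "metric_ANR X" and "path_connected_space X"
    and "metric_ANR Y" and "path_connected_space Y"
    and "hurewicz_fibration X Y f"
    and "f ` topspace X = topspace Y"
    and "y0 \<in> topspace Y" and "w0 \<in> topspace (prod_topology X Y)"
  shows "LS_cat Y y0 \<le> TC_map X Y f \<and>
         TC_map X Y f \<le> min (TC Y) (LS_cat (prod_topology X Y) w0) \<and>
         (TC_map X Y f = 1 \<longleftrightarrow> contractible_space Y)"
proof -
  \<comment> \<open>Surjectivity puts the arbitrary base point \<open>y0\<close> in the form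
    \<open>f x0\<close> that the slice argument provides.\<close>
  obtain x0 where x0: "x0 \<in> topspace X" "f x0 = y0"
    using assms(6,7) by (metis imageE)
  then have "TC_map X Y f = 1 \<longleftrightarrow> contractible_space Y"
    using TC_map_eq_1_iff[OF assms(5)] by blast
  then show ?thesis
    using LS_cat_le_TC_map[OF assms(5) x0(1)] TC_map_le_TC[OF assms(5)]
      TC_map_le_LS_cat_prod[OF assms(5,4,8)] x0(2) by simp
qed

end
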